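(* Let $p$ be a polynomial of degree less than four of the form $p(z)=1+az^k+\text{(higher order terms)}$, with $a\in\mathbb{C}\setminus\{0\}$ and $k\in\mathbb{N}=\{1,2,\dots\}$. If $p$ is magic, then $\#J_p=2\mu_p$.
   Context: For an entire function $f$, $M(r,f)=\max_{|z|=r}|f(z)|$ and the maximum modulus set is $\mathcal{M}(f)=\{z\in\mathbb{C}:|f(z)|=M(|z|,f)\}$. Let $f(z)=1+az^k+\text{(higher order terms)}$ be entire with $a\ne0$, $k\in\mathbb{N}$. The inner degree $\mu_f$ is the maximal $\mu\in\mathbb{N}$ such that $f(z)=\tilde f(z^\mu)$ for some entire function $\tilde f$. The set $J_f$: let $\Sigma=\{0,\dots,k-1\}$, $\omega_j=(2j\pi-\arg a)/k$ (with a fixed choice of $\arg a$), and for $r,\phi>0$ let $S_j(r,\phi)=\{z: 0<|z|\le r,\ |\arg z-\omega_j|<\phi\}$ (arguments modulo $2\pi$). For $T\subset\mathbb{C}$ let $\mathcal{M}(f|_T)=\{z\in T:|f(z)|=\max_{w\in T:|w|=|z|}|f(w)|\}$. There exist $R,\phi>0$ such that the sets $\gamma_j=\mathcal{M}(f|_{S_j(R,\phi)})$, $j\in\Sigma$, are disjoint analytic curves, each containing exactly one point of each modulus in $(0,R]$ and tangent at the origin to the ray $\arg z=\omega_j$, and such that $\mathcal{M}(f)\cap\{z:0<|z|\le R\}=\bigcup_{j\in J_f}\gamma_j$ for some $J_f\subset\Sigma$. The set $J_f$ does not depend on $R$ once $R$ is small enough, and $\#J_f$ is the number of curves making up $\mathcal{M}(f)$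 near the origin; it is always a multiple of $\mu_f$. $f$ is called magic if $\#J_f>\mu_f$. *)

theory Defs
  imports "HOL-Complex_Analysis.Complex_Analysis" "HOL-Computational_Algebra.Polynomial"
begin

definition max_modulus :: "real \<Rightarrow> (complex \<Rightarrow> complex) \<Rightarrow> real" where
  "max_modulus r f = (SUP z\<in>sphere 0 r. norm (f z))"

definition max_modulus_set :: "(complex \<Rightarrow> complex) \<Rightarrow> complex set" where
  "max_modulus_set f = {z. norm (f z) = max_modulus (norm z) f}"

text \<open>The relative version for a set \<open>T\<close> that need not be closed: \<open>z\<close> belongs to it iff the
  maximum of the modulus over the points of \<open>T\<close> on the circle through \<open>z\<close> is attained at \<open>z\<close>.\<close>

definition max_modulus_set_on :: "complex set \<Rightarrow> (complex \<Rightarrow> complex) \<Rightarrow> complex set" where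
  "max_modulus_set_on T f =
     {z\<in>T. \<forall>w\<in>T. norm w = norm z \<longrightarrow> norm (f w) \<le> norm (f z)}"

definition inner_degree :: "(complex \<Rightarrow> complex) \<Rightarrow> nat" where
  "inner_degree f =
     (GREATEST m. m \<ge> 1 \<and> (\<exists>g. g holomorphic_on UNIV \<and> (\<forall>z. f z = g (z ^ m))))"

text \<open>From here on \<open>a\<close> and \<open>k\<close> are the data of the expansion \<open>f(z) = 1 + a z^k + \<dots>\<close>, with
  \<open>a \<noteq> 0\<close> and \<open>k \<ge> 1\<close>; they are determined by \<open>f\<close>. The argument of \<open>a\<close> is the principal one;
  another choice only permutes the indices cyclically.\<close>

definition ray_angle :: "complex \<Rightarrow> nat \<Rightarrow> nat \<Rightarrow> real" where
  "ray_angle a k j = (2 * real j * pi - Arg a) / real k"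

definition ray_sector :: "complex \<Rightarrow> nat \<Rightarrow> nat \<Rightarrow> real \<Rightarrow> real \<Rightarrow> complex set" where
  "ray_sector a k j r \<phi> =
     {z. 0 < norm z \<and> norm z \<le> r \<and> (\<exists>t. is_Arg z t \<and> \<bar>t - ray_angle a k j\<bar> < \<phi>)}"

definition sector_curve ::
    "(complex \<Rightarrow> complex) \<Rightarrow> complex \<Rightarrow> nat \<Rightarrow> real \<Rightarrow> real \<Rightarrow> nat \<Rightarrow> complex set" where
  "sector_curve f a k R \<phi> j = max_modulus_set_on (ray_sector a k j R \<phi>) f"

text \<open>A regular simple real-analytic curve, parametrised over the half-open interval \<open>(0,1]\<close>
  (the curves below omit the origin). Real analyticity of the parametrisation is expressed by a
  holomorphic extension to a complex neighbourhood of the interval.\<close>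

definition analytic_curve :: "complex set \<Rightarrow> bool" where
  "analytic_curve C \<longleftrightarrow>
     (\<exists>g U. open U \<and> of_real ` {0<..1::real} \<subseteq> U \<and> g holomorphic_on U \<and>
        inj_on g (of_real ` {0<..1}) \<and> (\<forall>t\<in>{0<..1::real}. deriv g (of_real t) \<noteq> 0) \<and>
        C = g ` of_real ` {0<..1})"

definition tangent_to_ray :: "complex set \<Rightarrow> real \<Rightarrow> bool" where
  "tangent_to_ray C \<theta> \<longleftrightarrow> (sgn \<longlongrightarrow> cis \<theta>) (at 0 within C)"

definition curve_system ::
    "(complex \<Rightarrow> complex) \<Rightarrow> complex \<Rightarrow> nat \<Rightarrow> real \<Rightarrow> real \<Rightarrow> bool" where
  "curve_system f a k R \<phi> \<longleftrightarrow>
     disjoint_family_on (sector_curve f a k R \<phi>) {..<k} \<and>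
     (\<forall>j<k. analytic_curve (sector_curve f a k R \<phi> j) \<and>
            (\<forall>r\<in>{0<..R}. \<exists>!z. z \<in> sector_curve f a k R \<phi> j \<and> norm z = r) \<and>
            tangent_to_ray (sector_curve f a k R \<phi> j) (ray_angle a k j))"

definition is_curve_index_set ::
    "(complex \<Rightarrow> complex) \<Rightarrow> complex \<Rightarrow> nat \<Rightarrow> nat set \<Rightarrow> bool" where
  "is_curve_index_set f a k J \<longleftrightarrow>
     J \<subseteq> {..<k} \<and>
     (\<exists>R>0. \<exists>\<phi>>0. curve_system f a k R \<phi> \<and>
        max_modulus_set f \<inter> {z. 0 < norm z \<and> norm z \<le> R} = (\<Union>j\<in>J. sector_curve f a k R \<phi> j))"

text \<open>There is at most one \<open>J\<close> as in the previous definition, whatever \<open>R\<close> and \<open>\<phi>\<close> are; hence the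
  union below just picks it out (see \<open>curve_index_set_eq\<close>).\<close>

definition curve_index_set :: "(complex \<Rightarrow> complex) \<Rightarrow> complex \<Rightarrow> nat \<Rightarrow> nat set" where
  "curve_index_set f a k = \<Union> {J. is_curve_index_set f a k J}"

definition magic :: "(complex \<Rightarrow> complex) \<Rightarrow> complex \<Rightarrow> nat \<Rightarrow> bool" where
  "magic f a k \<longleftrightarrow> card (curve_index_set f a k) > inner_degree f"

lemma tangent_to_ray_is_Arg:
  assumes "tangent_to_ray C \<theta>" "\<epsilon> > 0"
  obtains \<rho> where "\<rho> > 0"
    "\<And>z. z \<in> C \<Longrightarrow> 0 < norm z \<Longrightarrow> norm z < \<rho> \<Longrightarrow> \<exists>t. is_Arg z t \<and> \<bar>t - \<theta>\<bar> < \<epsilon>"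
proof -
  have "((\<lambda>z. sgn z * cis (-\<theta>)) \<longlongrightarrow> cis \<theta> * cis (-\<theta>)) (at 0 within C)"
    using assms(1) unfolding tangent_to_ray_def by (intro tendsto_intros)
  hence "((\<lambda>z. sgn z * cis (-\<theta>)) \<longlongrightarrow> 1) (at 0 within C)"
    by (simp add: cis_mult)
  moreover have "isCont Arg 1"
    by (rule continuous_at_Arg) auto
  ultimately have "((\<lambda>z. Arg (sgn z * cis (-\<theta>))) \<longlongrightarrow> Arg 1) (at 0 within C)"
    using isCont_tendsto_compose by blast
  hence "\<forall>\<^sub>F z in at 0 within C. dist (Arg (sgn z * cis (-\<theta>))) 0 < \<epsilon>"
    using assms(2) by (auto simp: tendsto_iff)
  then obtain \<rho> where \<rho>: "\<rho> > 0"
    "\<And>z. z \<in> C \<Longrightarrow> z \<noteq> 0 \<Longrightarrow> dist z 0 < \<rho> \<Longrightarrow> dist (Arg (sgn z * cis (-\<theta>))) 0 < \<epsilon>"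
    unfolding eventually_at by auto
  have "\<exists>t. is_Arg z t \<and> \<bar>t - \<theta>\<bar> < \<epsilon>" if z: "z \<in> C" "0 < norm z" "norm z < \<rho>" for z
  proof (intro exI conjI)
    let ?s = "Arg (sgn z * cis (-\<theta>))"
    show "\<bar>(\<theta> + ?s) - \<theta>\<bar> < \<epsilon>" using \<rho>(2)[of z] z by auto
    have nz: "z \<noteq> 0" using z by auto
    have "cis ?s = sgn z * cis (-\<theta>)"
      using nz by (simp add: cis_Arg sgn_mult sgn_zero_iff)
    hence "cis (\<theta> + ?s) = sgn z"
      by (simp add: cis_mult[symmetric] mult.left_commute[of "cis \<theta>"])
         (simp add: cis_mult)
    hence "of_real (norm z) * cis (\<theta> + ?s) = z"
      using nz by (simp add: sgn_eq)
    thus "is_Arg z (\<theta> + ?s)"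
      unfolding is_Arg_def cis_conv_exp by simp
  qed
  with \<rho>(1) show ?thesis using that by blast
qed

lemma sector_curve_local:
  assumes "curve_system f a k R \<phi>" "curve_system f a k R' \<phi>'" "j < k"
    and pos: "R > 0" "R' > 0" "\<phi> > 0" "\<phi>' > 0"
  obtains \<rho> where "\<rho> > 0"
    "\<And>z. norm z < \<rho> \<Longrightarrow> z \<in> sector_curve f a k R \<phi> j \<Longrightarrow> z \<in> sector_curve f a k R' \<phi>' j"
proof -
  let ?C = "sector_curve f a k R \<phi> j" and ?C' = "sector_curve f a k R' \<phi>' j"
  let ?\<theta> = "ray_angle a k j" and ?\<epsilon> = "min \<phi> \<phi>'"
  have \<epsilon>: "?\<epsilon> > 0" using pos by simp
  have tan: "tangent_to_ray ?C ?\<theta>" "tangent_to_ray ?C' ?\<theta>"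
    and ex1: "\<forall>r\<in>{0<..R'}. \<exists>!z. z \<in> ?C' \<and> norm z = r"
    using assms(1-3) unfolding curve_system_def by blast+
  have ex: "\<exists>z. z \<in> ?C' \<and> norm z = r" if "0 < r" "r \<le> R'" for r
    using ex1 that by (meson greaterThanAtMost_iff)
  obtain \<rho>1 where \<rho>1: "\<rho>1 > 0"
    "\<And>z. z \<in> ?C \<Longrightarrow> 0 < norm z \<Longrightarrow> norm z < \<rho>1 \<Longrightarrow> \<exists>t. is_Arg z t \<and> \<bar>t - ?\<theta>\<bar> < ?\<epsilon>"
    using tangent_to_ray_is_Arg[OF tan(1) \<epsilon>] by blast
  obtain \<rho>2 where \<rho>2: "\<rho>2 > 0"
    "\<And>z. z \<in> ?C' \<Longrightarrow> 0 < norm z \<Longrightarrow> norm z < \<rho>2 \<Longrightarrow> \<exists>t. is_Arg z t \<and> \<bar>t - ?\<theta>\<bar> < ?\<epsilon>"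
    using tangent_to_ray_is_Arg[OF tan(2) \<epsilon>] by blast
  let ?\<rho> = "Min {\<rho>1, \<rho>2, R, R'}"
  show ?thesis
  proof (rule that)
    show "?\<rho> > 0" using \<rho>1(1) \<rho>2(1) pos by simp
    fix z assume z: "norm z < ?\<rho>" "z \<in> ?C"
    have z0: "0 < norm z" using z(2)
      by (auto simp: sector_curve_def max_modulus_set_on_def ray_sector_def)
    obtain w where w: "w \<in> ?C'" "norm w = norm z" using ex[of "norm z"] z0 z(1) by auto
    obtain s where s: "is_Arg z s" "\<bar>s - ?\<theta>\<bar> < ?\<epsilon>" using \<rho>1(2)[of z] z z0 by auto
    obtain t where t: "is_Arg w t" "\<bar>t - ?\<theta>\<bar> < ?\<epsilon>" using \<rho>2(2)[of w] w z z0 by auto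
    have zS: "z \<in> ray_sector a k j R' \<phi>'" using s z0 z(1) by (auto simp: ray_sector_def)
    have wS: "w \<in> ray_sector a k j R \<phi>" using t z0 z(1) w by (auto simp: ray_sector_def)
    have "norm (f w) \<le> norm (f z)"
      using z(2) wS w(2) by (auto simp: sector_curve_def max_modulus_set_on_def)
    thus "z \<in> ?C'"
      using w zS unfolding sector_curve_def max_modulus_set_on_def by force
  qed
qed

lemma is_curve_index_set_subset:
  assumes "is_curve_index_set f a k J" "is_curve_index_set f a k J'"
  shows "J \<subseteq> J'"
proof
  fix j assume j: "j \<in> J"
  obtain R \<phi> where R: "J \<subseteq> {..<k}" "R > 0" "\<phi> > 0" "curve_system f a k R \<phi>"
    "max_modulus_set f \<inter> {z. 0 < norm z \<and> norm z \<le> R} = (\<Union>j\<in>J. sector_curve f a k R \<phi> j)"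
    using assms(1) unfolding is_curve_index_set_def by blast
  obtain R' \<phi>' where R': "J' \<subseteq> {..<k}" "R' > 0" "\<phi>' > 0" "curve_system f a k R' \<phi>'"
    "max_modulus_set f \<inter> {z. 0 < norm z \<and> norm z \<le> R'} = (\<Union>j\<in>J'. sector_curve f a k R' \<phi>' j)"
    using assms(2) unfolding is_curve_index_set_def by blast
  have jk: "j < k" using j R(1) by auto
  obtain \<rho> where \<rho>: "\<rho> > 0"
    "\<And>z. norm z < \<rho> \<Longrightarrow> z \<in> sector_curve f a k R \<phi> j \<Longrightarrow> z \<in> sector_curve f a k R' \<phi>' j"
    using sector_curve_local[OF R(4) R'(4) jk R(2) R'(2) R(3) R'(3)] by blast
  define r where "r = Min {\<rho>, R, R'} / 2"
  have "Min {\<rho>, R, R'} > 0" "Min {\<rho>, R, R'} \<le> \<rho>" "Min {\<rho>, R, R'} \<le> R" "Min {\<rho>, R, R'} \<le> R'"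
    using \<rho>(1) R(2) R'(2) by auto
  hence r: "0 < r" "r < \<rho>" "r \<le> R" "r \<le> R'" unfolding r_def by linarith+
  obtain z where z: "z \<in> sector_curve f a k R \<phi> j" "norm z = r"
    using R(4) jk r unfolding curve_system_def by (metis greaterThanAtMost_iff)
  have z': "z \<in> sector_curve f a k R' \<phi>' j" using \<rho>(2) z r by auto
  have "z \<in> max_modulus_set f \<inter> {z. 0 < norm z \<and> norm z \<le> R'}" using z j R(5) r by auto
  then obtain i where i: "i \<in> J'" "z \<in> sector_curve f a k R' \<phi>' i" using R'(5) by auto
  have "disjoint_family_on (sector_curve f a k R' \<phi>') {..<k}"
    using R'(4) unfolding curve_system_def by blast
  hence "i = j"
    using i z' jk R'(1) unfolding disjoint_family_on_def by blast
  thus "j \<in> J'" using i by simp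
qed

lemma curve_index_set_eq:
  assumes "is_curve_index_set f a k J"
  shows "curve_index_set f a k = J"
  using assms is_curve_index_set_subset unfolding curve_index_set_def by blast

end

theory Submission
  imports Defs
begin

text \<open>
  Counting settles the claim. The set \<open>J\<close> consists of indices below \<open>k\<close>, so it has at most \<open>k\<close>
  elements, and \<open>k \<le> degree p \<le> 3\<close> because the coefficient \<open>a\<close> of \<open>z^k\<close> is nonzero. A magic
  polynomial therefore satisfies \<open>\<mu> < card J \<le> k \<le> 3\<close>, where \<open>\<mu> \<ge> 1\<close> is the inner degree.
  This excludes \<open>k = 1\<close>. If \<open>k = 3\<close>, the bound on the degree leaves only \<open>p(z) = 1 + a z^3\<close>,
  whose inner degree is at least \<open>3\<close>, and this is excluded too. For \<open>k = 2\<close> the inequalities force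
  \<open>\<mu> = 1\<close> and \<open>card J = 2\<close>.

  Since the inner degree is a greatest element, lower bounds for it require that the admissible
  exponents be bounded; this is \<open>inner_exponent_le_degree\<close>.
\<close>

lemma card_curve_index_set_le: "card (curve_index_set f a k) \<le> k"
proof -
  have "curve_index_set f a k \<subseteq> {..<k}"
    unfolding curve_index_set_def is_curve_index_set_def by blast
  from card_mono[OF _ this] show ?thesis by simp
qed

text \<open>A function of \<open>z^m\<close> takes the same value at all \<open>m\<close>-th roots of unity, and a nonconstant
  polynomial takes a value at no more points than its degree.\<close>

lemma inner_exponent_le_degree:
  fixes p :: "complex poly"
  assumes "degree p > 0" "m \<ge> 1" "\<And>z. poly p z = g (z ^ m)"
  shows "m \<le> degree p"
proof -
  let ?q = "p - [:poly p 1:]"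
  have deg: "degree ?q \<le> degree p"
    by (intro degree_diff_le) simp_all
  have nz: "?q \<noteq> 0"
    using assms(1) by (metis degree_pCons_0 eq_iff_diff_eq_0 less_irrefl)
  have "{z. z ^ m = 1} \<subseteq> {z. poly ?q z = 0}"
    using assms(3) by auto
  hence "card {z::complex. z ^ m = 1} \<le> card {z. poly ?q z = 0}"
    by (intro card_mono poly_roots_finite nz)
  also have "\<dots> \<le> degree p"
    using card_poly_roots_bound[OF nz] deg by simp
  finally show ?thesis
    using card_roots_unity_eq[of m] assms(2) by simp
qed

lemma le_inner_degree_poly:
  fixes p :: "complex poly"
  assumes "degree p > 0" "m \<ge> 1" "g holomorphic_on UNIV" "\<And>z. poly p z = g (z ^ m)"
  shows "m \<le> inner_degree (poly p)"
  unfolding inner_degree_def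
proof (rule Greatest_le_nat)
  show "m \<ge> 1 \<and> (\<exists>g. g holomorphic_on UNIV \<and> (\<forall>z. poly p z = g (z ^ m)))"
    using assms by blast
  show "n \<le> degree p"
    if "n \<ge> 1 \<and> (\<exists>g. g holomorphic_on UNIV \<and> (\<forall>z. poly p z = g (z ^ n)))" for n
    using that inner_exponent_le_degree[OF assms(1)] by blast
qed

theorem corollary1p8:
  fixes p :: "complex poly" and a :: complex and k :: nat
  assumes "degree p < 4"
    and "a \<noteq> 0" and "k \<ge> 1"
    and "\<exists>q. p = 1 + monom a k + monom 1 (Suc k) * q"
    and "magic (poly p) a k"
  shows "card (curve_index_set (poly p) a k) = 2 * inner_degree (poly p)"
proof -
  obtain q where p: "p = 1 + monom a k + monom 1 (Suc k) * q"
    using assms(4) by blast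
  have "coeff p k = a"
    using assms(3) by (simp add: p coeff_monom_mult)
  hence k_le: "k \<le> degree p"
    using assms(2) by (intro le_degree) simp
  hence deg: "degree p > 0" using assms(3) by simp
  have "poly p holomorphic_on UNIV"
    unfolding poly_altdef by (intro holomorphic_intros)
  hence \<mu>: "1 \<le> inner_degree (poly p)"
    by (intro le_inner_degree_poly[OF deg, of 1 "poly p"]) simp_all
  have card: "inner_degree (poly p) < card (curve_index_set (poly p) a k)"
    using assms(5) unfolding magic_def .
  have "k \<noteq> 3"
  proof
    assume k: "k = 3"
    have "p = 1 + monom a 3"
    proof (rule poly_eqI)
      fix n
      show "coeff p n = coeff (1 + monom a 3) n"
      proof (cases "n \<le> 3")
        case True
        then show ?thesis by (simp add: p k coeff_monom_mult)
      next
        case False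
        then show ?thesis using assms(1) by (simp add: coeff_eq_0)
      qed
    qed
    hence "poly p z = 1 + a * z ^ 3" for z
      by (simp add: poly_monom)
    hence "3 \<le> inner_degree (poly p)"
      by (intro le_inner_degree_poly[OF deg, of 3 "\<lambda>w. 1 + a * w"] holomorphic_intros) simp_all
    with card card_curve_index_set_le[of "poly p" a k] k show False by simp
  qed
  with k_le assms(1) have "k \<le> 2" by simp
  with \<mu> card card_curve_index_set_le[of "poly p" a k] show ?thesis by simp
qed

end
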